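(* Let $a_1,\dots,a_n$ and $b_1,\dots,b_n$ be two collections of points in $\mathbb{R}^2$ such that $$|a_i-a_j|\ge |b_i-b_j|$$ for all $i$ and $j$, and let $A\subset\mathbb{R}^2$ be a convex polygon which contains $a_1,\dots,a_n$. Then there is a piecewise distance-preserving map $f\colon A\to\mathbb{R}^2$ such that $f(a_i)=b_i$ for all $i$.
   Context: $\mathbb{R}^2$ carries the standard Euclidean metric, and $A$ carries the metric restricted from $\mathbb{R}^2$. A map $f$ between metric spaces is distance-preserving if $|f(x)-f(y)|=|x-y|$ for all $x,y$ in its domain. A triangulation of the convex polygon $A$ here is a subdivision of $A$ into finitely many non-degenerate Euclidean simplices (triangles, together with all their sides and vertices) such that any two of them intersect in the empty set or in a common face. A map $f\colon A\to\mathbb{R}^2$ is piecewise distance-preserving if there is a triangulation of $A$ such that for every simplex $\Delta$ of the triangulation the restriction $f|_\Delta$ is distance-preserving. *)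

theory Defs
  imports "HOL-Analysis.Analysis"
begin

definition convex_polygon :: "(real^2) set \<Rightarrow> bool" where
  "convex_polygon A \<longleftrightarrow> polytope A \<and> aff_dim A = 2"

text \<open>
  A \<open>simplicial_complex\<close> is finite and closed under faces, its members are non-degenerate
  simplices, and any two of them meet in a common face. The library counts the empty set as a
  simplex (of dimension \<open>-1\<close>) and as a face of every convex set, so the empty set belongs to the
  complex and an empty intersection is included in the face condition. The last conjunct excludes
  sides and vertices that do not come from a triangle of the subdivision.
\<close>

definition triangulates :: "(real^2) set set \<Rightarrow> (real^2) set \<Rightarrow> bool" where
  "triangulates \<T> A \<longleftrightarrow>
     simplicial_complex \<T> \<and> \<Union>\<T> = A \<and>
     (\<forall>S\<in>\<T>. \<exists>\<Delta>\<in>\<T>. 2 simplex \<Delta> \<and> S face_of \<Delta>)"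

definition distance_preserving_on ::
    "'a::metric_space set \<Rightarrow> ('a \<Rightarrow> 'b::metric_space) \<Rightarrow> bool" where
  "distance_preserving_on S f \<longleftrightarrow> (\<forall>x\<in>S. \<forall>y\<in>S. dist (f x) (f y) = dist x y)"

text \<open>Only the values of \<open>f\<close> on \<open>A\<close> matter here, so the total function \<open>f\<close> represents its
  restriction to \<open>A\<close>.\<close>

definition piecewise_distance_preserving_on ::
    "(real^2) set \<Rightarrow> (real^2 \<Rightarrow> real^2) \<Rightarrow> bool" where
  "piecewise_distance_preserving_on A f \<longleftrightarrow>
     (\<exists>\<T>. triangulates \<T> A \<and> (\<forall>\<Delta>\<in>\<T>. distance_preserving_on \<Delta> f))"

end

theory Submission
  imports Defs
begin

text \<open>
  Following Brehm, the points are matched one at a time. Let \<open>h\<close> already match \<open>a\<^sub>1, \<dots>, a\<^sub>k\<close>, and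
  put \<open>p = a\<^bsub>k+1\<^esub>\<close>, \<open>q = b\<^bsub>k+1\<^esub>\<close>. The set \<open>\<Omega> = {x. |h x - q| > |x - p|}\<close> is star-shaped around \<open>p\<close>
  and avoids \<open>a\<^sub>1, \<dots>, a\<^sub>k\<close>; on its boundary the distance of \<open>h x\<close> to \<open>q\<close> equals that of \<open>x\<close> to \<open>p\<close>,
  so \<open>h\<close> on the boundary can be coned off, from \<open>p\<close> to \<open>q\<close>, to redefine \<open>h\<close> isometrically on \<open>\<Omega>\<close>.

  All maps live on the whole space, with pieces cut out by finitely many hyperplanes; \<open>A\<close> enters only
  when the pieces are triangulated. The start is a map folding the space along the coordinate
  hyperplanes and shifting it so far that, for every \<open>i\<close>, the points far away come strictly closer
  to \<open>b\<^sub>i\<close> than they were to \<open>a\<^sub>i\<close>. This keeps every \<open>\<Omega>\<close> bounded, so that every ray from \<open>p\<close> leaves it.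
\<close>

section \<open>Maps isometric on the cells of a hyperplane arrangement\<close>

text \<open>Equivalently, \<open>x\<close> and \<open>y\<close> lie in a common closed cell of the arrangement of the hyperplanes
  \<open>a \<bullet> z = b\<close>.\<close>

definition unseparated :: "('a::real_inner \<times> real) set \<Rightarrow> 'a \<Rightarrow> 'a \<Rightarrow> bool" where
  "unseparated I x y \<longleftrightarrow>
     (\<forall>(a,b)\<in>I. a \<bullet> x \<le> b \<and> a \<bullet> y \<le> b \<or> a \<bullet> x \<ge> b \<and> a \<bullet> y \<ge> b)"

text \<open>Neighbouring closed cells share their wall, so continuity across walls is built
  in.\<close>

definition arrangement_isometric ::
    "('a::real_inner \<times> real) set \<Rightarrow> ('a \<Rightarrow> 'b::metric_space) \<Rightarrow> bool" where
  "arrangement_isometric I h \<longleftrightarrow>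
     finite I \<and> (\<forall>x y. unseparated I x y \<longrightarrow> dist (h x) (h y) = dist x y)"

lemma unseparatedD:
  "unseparated I x y \<Longrightarrow> (a,b) \<in> I \<Longrightarrow>
     a \<bullet> x \<le> b \<and> a \<bullet> y \<le> b \<or> a \<bullet> x \<ge> b \<and> a \<bullet> y \<ge> b"
  unfolding unseparated_def by blast

lemma unseparated_mono: "unseparated I x y \<Longrightarrow> J \<subseteq> I \<Longrightarrow> unseparated J x y"
  unfolding unseparated_def by blast

lemma unseparated_commute: "unseparated I x y \<longleftrightarrow> unseparated I y x"
  unfolding unseparated_def by blast

text \<open>A segment is cut at a hyperplane that strictly separates its ends. Both pieces cross
  fewer hyperplanes, and a piece that crosses none has the distance of its ends preserved.\<close>

lemma arrangement_isometric_short: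
  assumes "arrangement_isometric I h"
  shows "dist (h x) (h y) \<le> dist x y"
proof -
  define sep where "sep x y = {(a,b)\<in>I. a \<bullet> x < b \<and> b < a \<bullet> y \<or> a \<bullet> y < b \<and> b < a \<bullet> x}" for x y
  have fin: "finite I" using assms by (simp add: arrangement_isometric_def)
  have fs: "finite (sep x y)" for x y
    by (rule finite_subset[OF _ fin]) (auto simp: sep_def)
  show ?thesis
  proof (induction "card (sep x y)" arbitrary: x y rule: less_induct)
    case less
    show ?case
    proof (cases "sep x y = {}")
      case True
      then have "unseparated I x y"
        unfolding unseparated_def sep_def by force
      then show ?thesis using assms by (simp add: arrangement_isometric_def)
    next
      case False
      then obtain a b where ab: "(a,b) \<in> sep x y" by auto
      define t where "t = (b - a \<bullet> x) / (a \<bullet> y - a \<bullet> x)"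
      define z where "z = (1 - t) *\<^sub>R x + t *\<^sub>R y"
      have t: "0 \<le> t" "t \<le> 1"
        using ab by (auto simp: t_def sep_def divide_simps)
      have "t * (a \<bullet> y - a \<bullet> x) = b - a \<bullet> x"
        using ab by (auto simp: t_def sep_def)
      then have az: "a \<bullet> z = b"
        by (simp add: z_def inner_add_right algebra_simps)
      have between: "c \<bullet> z \<ge> d" if "c \<bullet> x \<ge> d" "c \<bullet> y \<ge> d" for c d
      proof -
        have "c \<bullet> z = (1 - t) * (c \<bullet> x) + t * (c \<bullet> y)"
          by (simp add: z_def inner_add_right)
        also have "\<dots> \<ge> (1 - t) * d + t * d"
          using that t by (intro add_mono mult_left_mono) auto
        finally show ?thesis by (simp add: algebra_simps)
      qed
      have between': "c \<bullet> z \<le> d" if "c \<bullet> x \<le> d" "c \<bullet> y \<le> d" for c d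
        using between[of "-d" "-c"] that by simp
      \<comment> \<open>\<open>z\<close> lies on the hyperplane \<open>(a,b)\<close>, which
        therefore separates it from nothing; as \<open>z\<close> is between \<open>x\<close> and
        \<open>y\<close>, no new separating hyperplane arises.\<close>
      have sub: "sep x z \<subseteq> sep x y - {(a,b)}" "sep z y \<subseteq> sep x y - {(a,b)}"
        using az by (auto simp: sep_def not_less; smt (verit) between between')+
      have card: "card (sep x z) < card (sep x y)" "card (sep z y) < card (sep x y)"
        using sub ab by (auto intro!: psubset_card_mono fs)
      have "dist (h x) (h y) \<le> dist (h x) (h z) + dist (h z) (h y)"
        by (rule dist_triangle)
      also have "\<dots> \<le> dist x z + dist z y"
        using less card by (intro add_mono) auto
      also have "\<dots> = dist x y"
      proof -
        have "x - z = t *\<^sub>R (x - y)" "z - y = (1 - t) *\<^sub>R (x - y)"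
          by (auto simp: z_def algebra_simps)
        then have "dist x z = t * dist x y" "dist z y = (1 - t) * dist x y"
          using t by (simp_all add: dist_norm)
        then show ?thesis by (simp add: algebra_simps)
      qed
      finally show ?thesis .
    qed
  qed
qed

lemma arrangement_isometric_translate:
  fixes h :: "'a::real_inner \<Rightarrow> 'b::real_normed_vector"
  assumes "arrangement_isometric I h"
  shows "arrangement_isometric ((\<lambda>(a,b). (a, b - a \<bullet> p)) ` I) (\<lambda>x. h (x + p) - q)"
  unfolding arrangement_isometric_def
proof (intro conjI allI impI)
  show "finite ((\<lambda>(a,b). (a, b - a \<bullet> p)) ` I)"
    using assms by (simp add: arrangement_isometric_def)
  fix x y assume "unseparated ((\<lambda>(a,b). (a, b - a \<bullet> p)) ` I) x y"
  then have "unseparated I (x + p) (y + p)"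
    by (fastforce simp: unseparated_def inner_add_right algebra_simps)
  then have "dist (h (x + p)) (h (y + p)) = dist (x + p) (y + p)"
    using assms by (simp add: arrangement_isometric_def)
  then show "dist (h (x + p) - q) (h (y + p) - q) = dist x y"
    by (simp add: dist_norm)
qed

section \<open>Triangulating the polygon\<close>

text \<open>Cutting \<open>A\<close> along the hyperplanes and subdividing the pieces into simplices
  puts each simplex into one cell. The remaining work is to show that every simplex is a face of a
  triangle.\<close>

lemma arrangement_isometric_triangulation:
  fixes f :: "real^2 \<Rightarrow> real^2"
  assumes f: "arrangement_isometric I f" and A: "convex_polygon A"
  shows "piecewise_distance_preserving_on A f"
proof -
  have A': "polytope A" "aff_dim A = 2" "convex A"
    using A by (auto simp: convex_polygon_def polytope_imp_convex)
  obtain \<G> where G: "\<Union>\<G> = \<Union>{A}" "finite \<G>" "\<forall>X\<in>\<G>. polytope X"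
      "\<forall>X \<in> \<G>. \<forall>Y \<in> \<G>. X \<inter> Y face_of X"
    and Gun: "\<forall>X \<in> \<G>. \<forall>x \<in> X. \<forall>y \<in> X. \<forall>a b. (a,b) \<in> I \<longrightarrow>
                a \<bullet> x \<le> b \<and> a \<bullet> y \<le> b \<or> a \<bullet> x \<ge> b \<and> a \<bullet> y \<ge> b"
    using cell_subdivision_lemma[of "{A}" 2 I] A' f
    by (auto simp: arrangement_isometric_def polytope_imp_convex face_of_refl)
  obtain \<T> where T: "simplicial_complex \<T>" "\<Union>\<T> = \<Union>\<G>"
    and TG: "\<And>K. K \<in> \<T> \<Longrightarrow> \<exists>C. C \<in> \<G> \<and> K \<subseteq> C"
    using simplicial_subdivision_of_cell_complex[of \<G>] G by metis
  have TA: "\<Union>\<T> = A" using T G by simp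
  have simp: "\<exists>n. n simplex S" if "S \<in> \<T>" for S
    using T that by (auto simp: simplicial_complex_def)
  \<comment> \<open>Simplices of lower dimension are nowhere dense in \<open>A\<close>, so the
    triangles alone cover it.\<close>
  have full: "\<Union>{C \<in> \<T>. aff_dim C = aff_dim A} = A"
  proof (intro convex_Union_fulldim_cells TA A')
    show "finite \<T>" using T by (simp add: simplicial_complex_def)
    show "closed C" "convex C" if "C \<in> \<T>" for C
      using simp[OF that] closed_simplex convex_simplex by blast+
  qed
  have simplex2: "2 simplex S" if "S \<in> \<T>" "aff_dim S = 2" for S
    using simp[OF that(1)] aff_dim_simplex that(2) by metis
  have pure: "\<exists>\<Delta>\<in>\<T>. 2 simplex \<Delta> \<and> S face_of \<Delta>" if S: "S \<in> \<T>" for S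
  proof (cases "S = {}")
    case True
    have "A \<noteq> {}" using A' by auto
    then obtain \<Delta> where "\<Delta> \<in> \<T>" "aff_dim \<Delta> = 2" using full A' by auto
    then show ?thesis using True simplex2 by auto
  next
    case False
    have "convex S" using simp[OF S] convex_simplex by auto
    \<comment> \<open>A face of \<open>S\<close> that contains a relative interior point of
      \<open>S\<close> is all of \<open>S\<close>.\<close>
    then obtain x where x: "x \<in> rel_interior S"
      using False rel_interior_eq_empty by blast
    then have "x \<in> S" using rel_interior_subset by blast
    then have "x \<in> A" using TA S by auto
    then obtain \<Delta> where D: "\<Delta> \<in> \<T>" "aff_dim \<Delta> = 2" "x \<in> \<Delta>" using full A' by auto
    have "S \<inter> \<Delta> face_of S" and face: "\<Delta> \<inter> S face_of \<Delta>"
      using T S D unfolding simplicial_complex_def by blast+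
    from this(1) have "S \<subseteq> S \<inter> \<Delta>"
      by (rule subset_of_face_of) (use x D \<open>x \<in> S\<close> in auto)
    then have "\<Delta> \<inter> S = S" by blast
    then have "S face_of \<Delta>" using face by simp
    then show ?thesis using D simplex2 by blast
  qed
  have "distance_preserving_on \<Delta> f" if D: "\<Delta> \<in> \<T>" for \<Delta>
  proof -
    obtain C where C: "C \<in> \<G>" "\<Delta> \<subseteq> C" using TG D by blast
    have "unseparated I x y" if "x \<in> \<Delta>" "y \<in> \<Delta>" for x y
      using Gun C that unfolding unseparated_def by blast
    then show ?thesis
      using f by (auto simp: distance_preserving_on_def arrangement_isometric_def)
  qed
  then show ?thesis
    unfolding piecewise_distance_preserving_on_def triangulates_def
    using T TA pure by blast
qed

section \<open>Tools for coning: isometries, short steps, rays\<close>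

text \<open>After shifting \<open>p\<close> and \<open>h p\<close> to the origins, \<open>h\<close>
  agrees on \<open>C\<close> with a linear map that preserves the norms involved, so the quadratic
  terms cancel. Inside a cell, comparing \<open>norm (h x)\<close> with \<open>norm x\<close> thus
  becomes a linear inequality.\<close>

lemma isometric_norm_diff_affine:
  fixes h :: "'a::euclidean_space \<Rightarrow> 'b::euclidean_space"
  assumes iso: "\<And>x y. x \<in> C \<Longrightarrow> y \<in> C \<Longrightarrow> dist (h x) (h y) = dist x y"
  shows "\<exists>a b. \<forall>x\<in>C. (norm (h x))\<^sup>2 - (norm x)\<^sup>2 = a \<bullet> x + b"
proof (cases "C = {}")
  case False
  then obtain p where p: "p \<in> C" by auto
  define k where "k x = h (p + x) - h p" for x
  define S where "S = {x. p + x \<in> C}"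
  have nk: "norm (k x - k y) = norm (x - y)" if "x \<in> S" "y \<in> S" for x y
    using iso[of "p+x" "p+y"] that by (simp add: k_def S_def dist_norm)
  have nk0: "norm (k x) = norm x" if "x \<in> S" for x
    using iso[of "p+x" p] that p by (simp add: k_def S_def dist_norm)
  have ik: "k x \<bullet> k y = x \<bullet> y" if "x \<in> S" "y \<in> S" for x y
    using nk[OF that] nk0[OF that(1)] nk0[OF that(2)]
    by (smt (verit) dot_norm_neg)
  obtain B where B: "B \<subseteq> S" "independent B" "S \<subseteq> span B"
    using maximal_independent_subset by blast
  obtain L where L: "linear L" "\<And>x. x \<in> B \<Longrightarrow> L x = k x"
    using linear_independent_extend[OF B(2)] by metis
  have fB: "finite B" using B(2) independent_imp_finite by blast
  \<comment> \<open>\<open>k x\<close> and \<open>L x\<close> both have the norm of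
    \<open>x\<close>, and their inner product is \<open>x \<bullet> x\<close>; so their difference
    has norm zero.\<close>
  have kL: "k x = L x" if x: "x \<in> S" for x
  proof -
    obtain c where c: "x = (\<Sum>b\<in>B. c b *\<^sub>R b)"
      using x B(3) span_finite[OF fB] by auto
    have Lx: "L x = (\<Sum>b\<in>B. c b *\<^sub>R k b)"
      unfolding c linear_sum[OF L(1)] linear_cmul[OF L(1)] using L(2) by simp
    have 1: "L x \<bullet> k y = x \<bullet> y" if "y \<in> S" for y
    proof -
      have "L x \<bullet> k y = (\<Sum>b\<in>B. c b * (k b \<bullet> k y))"
        unfolding Lx by (simp add: inner_sum_left)
      also have "\<dots> = (\<Sum>b\<in>B. c b * (b \<bullet> y))"
        using ik B that by (intro sum.cong) auto
      also have "\<dots> = x \<bullet> y" unfolding c by (simp add: inner_sum_left)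
      finally show ?thesis .
    qed
    have "L x \<bullet> L x = (\<Sum>b\<in>B. c b * (L x \<bullet> k b))"
      by (subst (2) Lx) (simp add: inner_sum_right)
    also have "\<dots> = (\<Sum>b\<in>B. c b * (x \<bullet> b))"
      using 1 B by (intro sum.cong) auto
    also have "\<dots> = x \<bullet> x" unfolding c by (simp add: inner_sum_right)
    finally have "L x \<bullet> L x = x \<bullet> x" .
    then have "(k x - L x) \<bullet> (k x - L x) = 0"
      using 1[OF x] ik[OF x x] by (simp add: inner_diff inner_commute)
    then show ?thesis by simp
  qed
  define w where "w = adjoint L (h p)"
  have w: "L x \<bullet> h p = x \<bullet> w" for x
    unfolding w_def using adjoint_works[OF L(1)] by (simp add: inner_commute)
  have "(norm (h x))\<^sup>2 - (norm x)\<^sup>2 =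
      (2 *\<^sub>R (w - p)) \<bullet> x + (h p \<bullet> h p - 2 * (w \<bullet> p) + p \<bullet> p)" if x: "x \<in> C" for x
  proof -
    define d where "d = x - p"
    have d: "d \<in> S" "x = p + d" using x by (auto simp: d_def S_def)
    have hx: "h x = h p + L d" using kL[OF d(1)] d(2) by (simp add: k_def algebra_simps)
    have "L d \<bullet> L d = d \<bullet> d" using ik[OF d(1) d(1)] kL[OF d(1)] by simp
    then show ?thesis
      unfolding hx power2_norm_eq_inner using w[of d]
      by (simp add: d(2) inner_add inner_diff inner_commute algebra_simps)
  qed
  then show ?thesis by blast
qed auto

text \<open>A hyperplane through \<open>z\<close> separates \<open>z\<close> from nothing, and one
  that misses \<open>z\<close> is not reached by a short enough step; finiteness gives a common
  step.\<close>

lemma unseparated_ray: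
  fixes z v :: "'a::real_inner"
  assumes "finite I"
  shows "\<exists>\<epsilon>>0. unseparated I z (z + \<epsilon> *\<^sub>R v)"
proof -
  have one: "\<forall>\<^sub>F s in at_right 0.
      a \<bullet> z \<le> b \<and> a \<bullet> (z + s *\<^sub>R v) \<le> b \<or> a \<bullet> z \<ge> b \<and> a \<bullet> (z + s *\<^sub>R v) \<ge> b" for a b
  proof -
    have lim: "((\<lambda>s. a \<bullet> (z + s *\<^sub>R v)) \<longlongrightarrow> a \<bullet> z) (at_right 0)"
      by (auto intro!: tendsto_eq_intros)
    consider "a \<bullet> z = b" | "a \<bullet> z < b" | "a \<bullet> z > b" by linarith
    then show ?thesis
    proof cases
      case 1
      then show ?thesis by (intro always_eventually) auto
    next
      case 2
      then show ?thesis using order_tendstoD(2)[OF lim, of b] by (auto elim: eventually_mono)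
    next
      case 3
      then show ?thesis using order_tendstoD(1)[OF lim, of b] by (auto elim: eventually_mono)
    qed
  qed
  have "\<forall>\<^sub>F s in at_right 0. unseparated I z (z + s *\<^sub>R v)"
    unfolding unseparated_def by (rule eventually_ball_finite[OF assms]) (auto simp: one)
  moreover have "\<forall>\<^sub>F s::real in at_right 0. s > 0"
    by (simp add: eventually_at_right_less)
  ultimately have "\<forall>\<^sub>F s in at_right 0. s > 0 \<and> unseparated I z (z + s *\<^sub>R v)"
    by eventually_elim auto
  from eventually_happens'[OF _ this] show ?thesis by auto
qed

text \<open>A ray may meet the set where \<open>h\<close> preserves the norm more than once; this
  makes the coned value independent of the point chosen. Shortness bounds
  \<open>u \<bullet> v\<close> below by the product of the norms, the equality case of
  Cauchy-Schwarz.\<close>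

lemma short_radial_unique:
  fixes h :: "'a::real_inner \<Rightarrow> 'b::real_inner"
  assumes short: "dist (h (s *\<^sub>R x)) (h (t *\<^sub>R x)) \<le> dist (s *\<^sub>R x) (t *\<^sub>R x)"
    and st: "s > 0" "t > 0"
    and s: "norm (h (s *\<^sub>R x)) = norm (s *\<^sub>R x)" and t: "norm (h (t *\<^sub>R x)) = norm (t *\<^sub>R x)"
  shows "h (s *\<^sub>R x) /\<^sub>R s = h (t *\<^sub>R x) /\<^sub>R t"
proof -
  define u v where "u = h (s *\<^sub>R x)" and "v = h (t *\<^sub>R x)"
  have uu: "u \<bullet> u = s\<^sup>2 * (x \<bullet> x)" and vv: "v \<bullet> v = t\<^sup>2 * (x \<bullet> x)"
    using s t st by (simp_all add: u_def v_def flip: power2_norm_eq_inner add: power_mult_distrib)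
  have "(norm (u - v))\<^sup>2 \<le> (norm (s *\<^sub>R x - t *\<^sub>R x))\<^sup>2"
    using short by (intro power_mono) (auto simp: u_def v_def dist_norm)
  then have uv: "u \<bullet> v \<ge> s * t * (x \<bullet> x)"
    unfolding power2_norm_eq_inner using uu vv
    by (simp add: inner_diff inner_commute power2_eq_square algebra_simps)
  have "(t *\<^sub>R u - s *\<^sub>R v) \<bullet> (t *\<^sub>R u - s *\<^sub>R v)
      = t\<^sup>2 * (u \<bullet> u) + s\<^sup>2 * (v \<bullet> v) - 2 * (s * t) * (u \<bullet> v)"
    by (simp add: inner_diff inner_commute power2_eq_square algebra_simps)
  also have "\<dots> \<le> t\<^sup>2 * (u \<bullet> u) + s\<^sup>2 * (v \<bullet> v) - 2 * (s * t) * (s * t * (x \<bullet> x))"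
    using uv st by (intro diff_left_mono mult_left_mono) auto
  also have "\<dots> = 0" unfolding uu vv by (simp add: power2_eq_square)
  finally have "(t *\<^sub>R u - s *\<^sub>R v) \<bullet> (t *\<^sub>R u - s *\<^sub>R v) = 0"
    by (intro order_antisym inner_ge_zero)
  then have "t *\<^sub>R u = s *\<^sub>R v" by (simp del: inner_diff_left inner_diff_right)
  then have "(t *\<^sub>R u) /\<^sub>R (s * t) = (s *\<^sub>R v) /\<^sub>R (s * t)" by simp
  then show ?thesis using st by (simp add: u_def v_def field_simps)
qed

lemma inner_eq_of_dist_eq:
  fixes x y :: "'a::real_inner" and p q :: "'b::real_inner"
  assumes "norm p = norm x" "norm q = norm y" "dist p q = dist x y"
  shows "p \<bullet> q = x \<bullet> y"
  using assms unfolding dist_norm dot_norm_neg by simp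

lemma dist_eq_of_inner_eq:
  fixes x y :: "'a::real_inner" and p q :: "'b::real_inner"
  assumes "norm p = norm x" "norm q = norm y" "p \<bullet> q = x \<bullet> y"
  shows "dist p q = dist x y"
proof -
  have "(dist p q)\<^sup>2 = (dist x y)\<^sup>2"
    using assms(3) arg_cong[OF assms(1), of "\<lambda>r. r\<^sup>2"] arg_cong[OF assms(2), of "\<lambda>r. r\<^sup>2"]
    unfolding dist_norm power2_norm_eq_inner by (simp add: inner_diff inner_commute)
  then show ?thesis by simp
qed

text \<open>Compactness gives a largest \<open>t \<ge> a\<close> with \<open>g t \<ge> 0\<close>;
  the negative values just after it force \<open>g t \<le> 0\<close> by continuity.\<close>

lemma exists_last_nonneg:
  fixes g :: "real \<Rightarrow> real"
  assumes cont: "continuous_on UNIV g" and "g a \<ge> 0" and neg: "\<And>t. t > R \<Longrightarrow> g t < 0"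
  shows "\<exists>t\<ge>a. g t = 0 \<and> (\<forall>s>t. g s < 0)"
proof -
  define S where "S = {a..R} \<inter> {t. g t \<ge> 0}"
  have "closed {t. 0 \<le> g t}" by (intro closed_Collect_le cont) auto
  then have "compact S" unfolding S_def by (intro compact_Int_closed) auto
  moreover have "a \<in> S" using assms(2) neg[of a] by (force simp: S_def)
  ultimately obtain t where t: "t \<in> S" "\<And>s. s \<in> S \<Longrightarrow> s \<le> t"
    using compact_attains_sup[of S] by blast
  have after: "g s < 0" if "s > t" for s
    using t(2)[of s] t(1) that neg[of s] by (force simp: S_def)
  have "(g \<longlongrightarrow> g t) (at_right t)"
    using cont by (meson UNIV_I continuous_on_def tendsto_within_subset subset_UNIV)
  then have "g t \<le> 0"
    by (rule tendsto_upperbound)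
       (auto intro!: eventually_at_rightI[of t "t+1"] less_imp_le after)
  then show ?thesis using t(1) after by (intro exI[of _ t]) (auto simp: S_def)
qed

section \<open>Coning off a star-shaped region\<close>

text \<open>The coning step, with \<open>p = q = 0\<close>.\<close>

lemma arrangement_isometric_fold_star:
  fixes h :: "'a::euclidean_space \<Rightarrow> 'b::euclidean_space"
  assumes h: "arrangement_isometric I h"
    and far: "\<forall>\<^sub>F x in at_infinity. norm (h x) < norm x"
  shows "\<exists>J f. arrangement_isometric J f \<and> f 0 = 0 \<and> (\<forall>x. norm (h x) \<le> norm x \<longrightarrow> f x = h x)"
proof -
  \<comment> \<open>\<open>\<Omega>\<close> is the set \<open>g > 0\<close>. Squared norms are used
    because their difference is affine on every cell.\<close>
  define g where "g x = (norm (h x))\<^sup>2 - (norm x)\<^sup>2" for x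
  have g_nonneg: "g x \<ge> 0 \<longleftrightarrow> norm (h x) \<ge> norm x" for x
    by (simp add: g_def abs_le_square_iff[symmetric])
  have g_0: "g x = 0 \<longleftrightarrow> norm (h x) = norm x" for x
    by (simp add: g_def)
  have finI: "finite I" and iso: "\<And>x y. unseparated I x y \<Longrightarrow> dist (h x) (h y) = dist x y"
    using h by (auto simp: arrangement_isometric_def)
  have short: "dist (h x) (h y) \<le> dist x y" for x y
    using h by (rule arrangement_isometric_short)
  obtain R where R: "\<And>x. norm x \<ge> R \<Longrightarrow> g x < 0"
    using far g_nonneg unfolding eventually_at_infinity by (metis not_le)
  have "continuous_on UNIV h"
    by (rule continuous_onI) (meson less_imp_le order_trans short)
  then have contg: "continuous_on UNIV g"
    unfolding g_def by (intro continuous_intros)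

  \<comment> \<open>\<open>P\<close> holds the hyperplanes with \<open>a \<bullet> x \<le> b\<close>
    on the cell, the others being reversed; the factor \<open>sg\<close> lets one inequality express
    both.\<close>
  define sg :: "('a \<times> real) set \<Rightarrow> 'a \<times> real \<Rightarrow> real"
    where "sg P ab = (if ab \<in> P then 1 else -1)" for P ab
  have sg: "sg P ab = 1 \<or> sg P ab = -1" for P ab by (simp add: sg_def)
  define cell where "cell P = {x. \<forall>(a,b)\<in>I. sg P (a,b) * (a \<bullet> x - b) \<le> 0}" for P
  have cellD: "sg P (a,b) * (a \<bullet> x - b) \<le> 0" if "x \<in> cell P" "(a,b) \<in> I" for P x a b
    using that by (auto simp: cell_def)
  have in_cell: "x \<in> cell P" if "\<And>a b. (a,b) \<in> I \<Longrightarrow> sg P (a,b) * (a \<bullet> x - b) \<le> 0" for P x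
    using that by (auto simp: cell_def)
  have cellI: "\<exists>P. P \<subseteq> I \<and> x \<in> cell P \<and> y \<in> cell P" if xy: "unseparated I x y" for x y
  proof (intro exI conjI in_cell)
    let ?P = "{(a,b)\<in>I. a \<bullet> x \<le> b \<and> a \<bullet> y \<le> b}"
    show "?P \<subseteq> I" by auto
    show "sg ?P (a,b) * (a \<bullet> x - b) \<le> 0" "sg ?P (a,b) * (a \<bullet> y - b) \<le> 0" if "(a,b) \<in> I" for a b
      using that unseparatedD[OF xy that] by (auto simp: sg_def)
  qed
  have cell_iso: "dist (h x) (h y) = dist x y" if xy: "x \<in> cell P" "y \<in> cell P" for x y P
  proof (rule iso)
    have "a \<bullet> x \<le> b \<and> a \<bullet> y \<le> b \<or> a \<bullet> x \<ge> b \<and> a \<bullet> y \<ge> b" if "(a,b) \<in> I" for a b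
      using cellD[OF xy(1) that] cellD[OF xy(2) that] sg[of P "(a,b)"] by auto
    then show "unseparated I x y" by (auto simp: unseparated_def)
  qed
  have "\<forall>P. \<exists>a b. \<forall>x\<in>cell P. g x = a \<bullet> x + b"
    unfolding g_def by (intro allI isometric_norm_diff_affine cell_iso)
  then obtain \<alpha> \<beta> where g_cell: "\<And>P x. x \<in> cell P \<Longrightarrow> g x = \<alpha> P \<bullet> x + \<beta> P"
    by metis

  \<comment> \<open>On \<open>cell P\<close> the boundary of \<open>\<Omega>\<close> lies on \<open>\<alpha> P \<bullet> x + \<beta> P = 0\<close>. Its intersection with a hyperplane
    \<open>a \<bullet> x = b\<close> spans, together with \<open>0\<close>, the hyperplane \<open>(\<beta> P *\<^sub>R a + b *\<^sub>R \<alpha> P) \<bullet> x = 0\<close>. The coordinate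
    hyperplanes separate \<open>x\<close> from \<open>-x\<close>.\<close>
  define J where "J = I \<union> (\<lambda>P. (\<alpha> P, - \<beta> P)) ` Pow I \<union> (\<lambda>P. (\<alpha> P, 0)) ` Pow I \<union>
     (\<lambda>(P,(a,b)). (\<beta> P *\<^sub>R a + b *\<^sub>R \<alpha> P, 0)) ` (Pow I \<times> I) \<union> (\<lambda>e. (e,0)) ` Basis"
  have finJ: "finite J" using finI by (simp add: J_def)
  have IJ: "I \<subseteq> J" by (auto simp: J_def)
  have J1: "(\<alpha> P, - \<beta> P) \<in> J" "(\<alpha> P, 0) \<in> J" if "P \<subseteq> I" for P
    using that by (auto simp: J_def)
  have J2: "(\<beta> P *\<^sub>R a + b *\<^sub>R \<alpha> P, 0) \<in> J" if "P \<subseteq> I" "(a,b) \<in> I" for P a b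
    unfolding J_def by (rule UnI1, rule UnI2, rule image_eqI[where x = "(P,(a,b))"]) (use that in auto)
  have J3: "(e, 0) \<in> J" if "e \<in> Basis" for e
    using that by (auto simp: J_def)
  have g_sign: "g x \<le> 0 \<and> g y \<le> 0 \<or> g x \<ge> 0 \<and> g y \<ge> 0" if xy: "unseparated J x y" for x y
  proof -
    obtain P where P: "P \<subseteq> I" "x \<in> cell P" "y \<in> cell P"
      using cellI unseparated_mono[OF xy IJ] by blast
    then show ?thesis using unseparatedD[OF xy J1(1)[OF P(1)]] by (auto simp: g_cell)
  qed

  \<comment> \<open>One \<open>P\<close> for both rays is the point: \<open>h\<close> is isometric
    on \<open>cell P\<close>, so the two boundary points keep their distance. The apex
    \<open>0\<close> determines no ray, hence \<open>w \<noteq> 0\<close>.\<close>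
  have cone: "\<exists>P. \<forall>w\<in>{x,y}. w \<noteq> 0 \<longrightarrow> (\<exists>\<tau>>0. \<tau> *\<^sub>R w \<in> cell P \<and> g (\<tau> *\<^sub>R w) = 0)"
    if xy: "unseparated J x y" "g x \<ge> 0" "g y \<ge> 0" "x \<noteq> 0 \<or> y \<noteq> 0" for x y
  proof -
    \<comment> \<open>\<open>P\<close> is the cell in which the ray through the midpoint leaves \<open>\<Omega>\<close> for the last time; the rays
      through \<open>x\<close> and \<open>y\<close> meet the boundary hyperplane of that same cell within it.\<close>
    define m where "m = (1/2) *\<^sub>R (x + y)"
    have m0: "m \<noteq> 0"
    proof
      assume "m = 0"
      then have "y = - x" by (simp add: m_def add_eq_0_iff)
      then have "e \<bullet> x = 0" if "e \<in> Basis" for e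
        using unseparatedD[OF xy(1) J3[OF that]] by auto
      then have "x = 0" using euclidean_all_zero_iff[of x] by (simp add: inner_commute)
      then show False using xy(4) \<open>y = - x\<close> by auto
    qed
    obtain Q where Q: "Q \<subseteq> I" "x \<in> cell Q" "y \<in> cell Q"
      using cellI unseparated_mono[OF xy(1) IJ] by blast
    have "m \<in> cell Q"
    proof (rule in_cell)
      fix a b assume ab: "(a,b) \<in> I"
      have "sg Q (a,b) * (a \<bullet> m - b) =
          (sg Q (a,b) * (a \<bullet> x - b) + sg Q (a,b) * (a \<bullet> y - b)) / 2"
        by (simp add: m_def inner_add_right field_simps)
      then show "sg Q (a,b) * (a \<bullet> m - b) \<le> 0"
        using cellD[OF Q(2) ab] cellD[OF Q(3) ab] by simp
    qed
    then have "g m = (g x + g y) / 2"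
      using Q by (simp add: g_cell[of _ Q]) (simp add: m_def inner_add_right field_simps)
    then have "g m \<ge> 0" using xy(2,3) by simp
    have "\<exists>t\<ge>1. g (t *\<^sub>R m) = 0 \<and> (\<forall>s>t. g (s *\<^sub>R m) < 0)"
    proof (rule exists_last_nonneg)
      show "continuous_on UNIV (\<lambda>t. g (t *\<^sub>R m))"
        by (rule continuous_on_compose2[OF contg]) (auto intro!: continuous_intros)
      show "g (1 *\<^sub>R m) \<ge> 0" using \<open>g m \<ge> 0\<close> by simp
      show "g (t *\<^sub>R m) < 0" if "t > \<bar>R\<bar> / norm m" for t
      proof (rule R)
        have "R \<le> t * norm m" using that m0 by (simp add: field_simps)
        also have "\<dots> \<le> norm (t *\<^sub>R m)" by (simp add: mult_right_mono)
        finally show "norm (t *\<^sub>R m) \<ge> R" .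
      qed
    qed
    then obtain t where t: "t \<ge> 1" "g (t *\<^sub>R m) = 0" "\<And>s. s > t \<Longrightarrow> g (s *\<^sub>R m) < 0"
      by blast
    \<comment> \<open>In the cell that the ray enters right after its last zero, \<open>g\<close>
      strictly decreases along \<open>m\<close>.\<close>
    obtain \<epsilon> where e: "\<epsilon> > 0" "unseparated I (t *\<^sub>R m) (t *\<^sub>R m + \<epsilon> *\<^sub>R m)"
      using unseparated_ray[OF finI] by blast
    then obtain P where P: "P \<subseteq> I" "t *\<^sub>R m \<in> cell P" "t *\<^sub>R m + \<epsilon> *\<^sub>R m \<in> cell P"
      using cellI by blast
    have g1: "t * (\<alpha> P \<bullet> m) + \<beta> P = 0" using g_cell[OF P(2)] t(2) by simp
    have "\<alpha> P \<bullet> (t *\<^sub>R m + \<epsilon> *\<^sub>R m) + \<beta> P < 0"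
      using g_cell[OF P(3)] t(3)[of "t + \<epsilon>"] e(1) by (simp add: scaleR_add_left)
    then have "\<epsilon> * (\<alpha> P \<bullet> m) < 0" using g1 by (simp add: inner_add_right)
    then have am: "\<alpha> P \<bullet> m < 0" using e(1) by (simp add: mult_less_0_iff)
    have bt: "\<beta> P = - (t * (\<alpha> P \<bullet> m))" using g1 by simp
    have bpos: "\<beta> P > 0" unfolding bt using am t(1) by (simp add: mult_pos_neg)
    have "\<exists>\<tau>>0. \<tau> *\<^sub>R w \<in> cell P \<and> g (\<tau> *\<^sub>R w) = 0"
      if w: "unseparated J w w'" "w + w' = 2 *\<^sub>R m" "w \<noteq> 0" for w w'
    proof -
      \<comment> \<open>A hyperplane of \<open>J\<close> through \<open>0\<close> has
        \<open>w\<close> and \<open>w'\<close> on one side, so a weak sign at their midpoint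
        \<open>m\<close> passes to \<open>w\<close>.\<close>
      have sgn: "c * (k \<bullet> w) \<le> 0" if "(k,0) \<in> J" "c * (k \<bullet> m) \<le> 0" "c = 1 \<or> c = -1" for c k
      proof -
        have "k \<bullet> w + k \<bullet> w' = 2 * (k \<bullet> m)"
          using arg_cong[OF w(2), of "\<lambda>z. k \<bullet> z"] by (simp add: inner_add_right)
        then show ?thesis using unseparatedD[OF w(1) that(1)] that(2,3) by auto
      qed
      have k: "sg P (a,b) * (\<beta> P * (a \<bullet> w) + b * (\<alpha> P \<bullet> w)) \<le> 0" if ab: "(a,b) \<in> I" for a b
      proof -
        \<comment> \<open>Where \<open>\<alpha> P \<bullet> z = - \<beta> P\<close>, the form
          \<open>?k \<bullet> z\<close> equals \<open>\<beta> P * (a \<bullet> z - b)\<close>: the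
          cell inequality made homogeneous, which \<open>sgn\<close> can carry from \<open>m\<close>
          to \<open>w\<close>.\<close>
        let ?k = "\<beta> P *\<^sub>R a + b *\<^sub>R \<alpha> P"
        have "sg P (a,b) * (?k \<bullet> m) =
            (- (\<alpha> P \<bullet> m)) * (sg P (a,b) * (a \<bullet> (t *\<^sub>R m) - b))"
          by (simp add: bt inner_add_left algebra_simps)
        also have "\<dots> \<le> 0"
          using am by (intro mult_nonneg_nonpos[OF _ cellD[OF P(2) ab]]) auto
        finally show ?thesis
          using sgn[OF J2[OF P(1) ab] _ sg] by (simp add: inner_add_left)
      qed
      have aw: "\<alpha> P \<bullet> w < 0"
      proof (rule ccontr)
        assume "\<not> \<alpha> P \<bullet> w < 0"
        then have aw0: "\<alpha> P \<bullet> w = 0" using sgn[OF J1(2)[OF P(1)], of 1] am by auto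
        \<comment> \<open>Otherwise \<open>g\<close> vanishes on an unbounded ray in direction \<open>w\<close>.\<close>
        define s where "s = (\<bar>R\<bar> + norm (t *\<^sub>R m)) / norm w"
        have s: "s \<ge> 0" by (simp add: s_def)
        have "t *\<^sub>R m + s *\<^sub>R w \<in> cell P"
        proof (rule in_cell)
          fix a b assume ab: "(a,b) \<in> I"
          \<comment> \<open>For \<open>\<alpha> P \<bullet> w = 0\<close> the inequality
            \<open>k\<close> makes \<open>w\<close> a recession direction of
            \<open>cell P\<close>.\<close>
          have "\<beta> P * (sg P (a,b) * (a \<bullet> w)) \<le> 0"
            using k[OF ab] aw0 by (simp add: mult.left_commute)
          then have "sg P (a,b) * (a \<bullet> w) \<le> 0"
            using bpos by (simp add: mult_le_0_iff)
          then have "s * (sg P (a,b) * (a \<bullet> w)) \<le> 0"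
            by (rule mult_nonneg_nonpos[OF s])
          then have "sg P (a,b) * (a \<bullet> (t *\<^sub>R m) - b) + s * (sg P (a,b) * (a \<bullet> w)) \<le> 0"
            using cellD[OF P(2) ab] by linarith
          then show "sg P (a,b) * (a \<bullet> (t *\<^sub>R m + s *\<^sub>R w) - b) \<le> 0"
            by (simp add: inner_add_right algebra_simps)
        qed
        then have "g (t *\<^sub>R m + s *\<^sub>R w) = 0"
          using g1 aw0 by (simp add: g_cell[of _ P] inner_add_right)
        moreover have "norm (t *\<^sub>R m + s *\<^sub>R w) \<ge> R"
        proof -
          have "norm (s *\<^sub>R w) = \<bar>R\<bar> + norm (t *\<^sub>R m)"
            using w(3) s by (simp add: s_def)
          then show ?thesis using norm_diff_ineq[of "s *\<^sub>R w" "t *\<^sub>R m"] by (simp add: add.commute)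
        qed
        ultimately show False using R by fastforce
      qed
      \<comment> \<open>The multiple of \<open>w\<close> on the hyperplane
        \<open>\<alpha> P \<bullet> z + \<beta> P = 0\<close>; \<open>k\<close> then puts it into
        \<open>cell P\<close>.\<close>
      define \<tau> where "\<tau> = - \<beta> P / (\<alpha> P \<bullet> w)"
      have tau: "\<tau> > 0" using aw bpos by (simp add: \<tau>_def divide_pos_neg)
      have ta: "\<tau> * (\<alpha> P \<bullet> w) = - \<beta> P" using aw by (simp add: \<tau>_def)
      have "\<tau> *\<^sub>R w \<in> cell P"
      proof (rule in_cell)
        fix a b assume ab: "(a,b) \<in> I"
        have "\<tau> * (\<beta> P * (a \<bullet> w) + b * (\<alpha> P \<bullet> w)) =
            \<beta> P * (\<tau> * (a \<bullet> w)) + b * (\<tau> * (\<alpha> P \<bullet> w))"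
          by (simp add: algebra_simps)
        also have "\<dots> = \<beta> P * (a \<bullet> (\<tau> *\<^sub>R w) - b)"
          unfolding ta by (simp add: algebra_simps)
        finally have "\<beta> P * (sg P (a,b) * (a \<bullet> (\<tau> *\<^sub>R w) - b)) =
            \<tau> * (sg P (a,b) * (\<beta> P * (a \<bullet> w) + b * (\<alpha> P \<bullet> w)))"
          by (metis mult.left_commute)
        also have "\<dots> \<le> 0"
          by (rule mult_nonneg_nonpos[OF less_imp_le[OF tau] k[OF ab]])
        finally show "sg P (a,b) * (a \<bullet> (\<tau> *\<^sub>R w) - b) \<le> 0"
          using bpos by (simp add: mult_le_0_iff)
      qed
      moreover from this have "g (\<tau> *\<^sub>R w) = 0" using ta by (simp add: g_cell[of _ P])
      ultimately show ?thesis using tau by blast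
    qed
    note ray = this
    have sum: "x + y = 2 *\<^sub>R m" "y + x = 2 *\<^sub>R m" by (simp_all add: m_def add.commute)
    show ?thesis
      using ray[OF xy(1) sum(1)] ray[OF _ sum(2)] xy(1) unseparated_commute[of J] by blast
  qed

  \<comment> \<open>Points with \<open>g x = 0\<close> fall under the cone clause, where
    \<open>t = 1\<close> is admissible and returns \<open>h x\<close>. By radial uniqueness any
    admissible \<open>t\<close> gives the same value.\<close>
  define f where "f x = (if x = 0 then 0 else if g x < 0 then h x else
      let t = (SOME t. t > 0 \<and> g (t *\<^sub>R x) = 0) in h (t *\<^sub>R x) /\<^sub>R t)" for x
  have f_cone: "f x = h (t *\<^sub>R x) /\<^sub>R t" if x: "x \<noteq> 0" "g x \<ge> 0" "t > 0" "g (t *\<^sub>R x) = 0" for x t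
  proof -
    define s where "s = (SOME t. t > 0 \<and> g (t *\<^sub>R x) = 0)"
    have "s > 0 \<and> g (s *\<^sub>R x) = 0"
      unfolding s_def using x by (intro someI[of "\<lambda>t. t > 0 \<and> g (t *\<^sub>R x) = 0" t]) auto
    then have "h (s *\<^sub>R x) /\<^sub>R s = h (t *\<^sub>R x) /\<^sub>R t"
      using x by (intro short_radial_unique short) (auto simp: g_0)
    then show ?thesis using x by (simp add: f_def s_def[symmetric] Let_def)
  qed
  have f_h: "f x = h x" if "g x \<le> 0" for x
  proof (cases "x = 0")
    case True
    then show ?thesis using that by (simp add: f_def g_def)
  next
    case False
    then show ?thesis using that f_cone[of x 1] by (cases "g x = 0") (auto simp: f_def)
  qed
  \<comment> \<open>On \<open>g \<ge> 0\<close> the map \<open>f\<close> preserves norms, and also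
    inner products, by scaling both points to the boundary inside one cell. Otherwise
    \<open>f\<close> is \<open>h\<close> at both points, or both are the apex.\<close>
  have "dist (f x) (f y) = dist x y" if xy: "unseparated J x y" for x y
  proof (cases "g x \<ge> 0 \<and> g y \<ge> 0 \<and> (x \<noteq> 0 \<or> y \<noteq> 0)")
    case True
    then have nonneg: "g x \<ge> 0" "g y \<ge> 0" "x \<noteq> 0 \<or> y \<noteq> 0" by auto
    from cone[OF xy this] obtain P where
      P: "\<forall>w\<in>{x,y}. w \<noteq> 0 \<longrightarrow> (\<exists>\<tau>>0. \<tau> *\<^sub>R w \<in> cell P \<and> g (\<tau> *\<^sub>R w) = 0)" ..
    have P': "\<exists>\<tau>>0. \<tau> *\<^sub>R w \<in> cell P \<and> norm (h (\<tau> *\<^sub>R w)) = \<tau> * norm w \<and> f w = h (\<tau> *\<^sub>R w) /\<^sub>R \<tau>"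
      if "w \<in> {x,y}" "w \<noteq> 0" for w
    proof -
      from P that obtain \<tau> where t: "\<tau> > 0" "\<tau> *\<^sub>R w \<in> cell P" "g (\<tau> *\<^sub>R w) = 0"
        by (elim ballE[of _ _ w] impE exE conjE) simp_all
      have "f w = h (\<tau> *\<^sub>R w) /\<^sub>R \<tau>"
        by (rule f_cone[OF that(2) _ t(1,3)]) (use nonneg that(1) in auto)
      moreover have "norm (h (\<tau> *\<^sub>R w)) = \<tau> * norm w"
        using t(1,3) by (simp add: g_0)
      ultimately show ?thesis using t(1,2) by (intro exI[of _ \<tau>] conjI)
    qed
    have nf: "norm (f w) = norm w" if "w \<in> {x,y}" for w
      using P'[OF that] by (cases "w = 0") (auto simp: f_def)
    show ?thesis
    proof (rule dist_eq_of_inner_eq)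
      show "norm (f x) = norm x" "norm (f y) = norm y" using nf by auto
      show "f x \<bullet> f y = x \<bullet> y"
      proof (cases "x = 0 \<or> y = 0")
        case True
        then show ?thesis by (auto simp: f_def)
      next
        case False
        obtain s where s: "s > 0" "s *\<^sub>R x \<in> cell P" "norm (h (s *\<^sub>R x)) = s * norm x"
          "f x = h (s *\<^sub>R x) /\<^sub>R s" using P'[of x] False by auto
        obtain t where t: "t > 0" "t *\<^sub>R y \<in> cell P" "norm (h (t *\<^sub>R y)) = t * norm y"
          "f y = h (t *\<^sub>R y) /\<^sub>R t" using P'[of y] False by auto
        have "h (s *\<^sub>R x) \<bullet> h (t *\<^sub>R y) = (s *\<^sub>R x) \<bullet> (t *\<^sub>R y)"
          using s t by (intro inner_eq_of_dist_eq cell_iso[of _ P]) auto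
        then show ?thesis using s t by (simp add: field_simps)
      qed
    qed
  next
    case False
    then consider "x = 0" "y = 0" | "g x \<le> 0" "g y \<le> 0" using g_sign[OF xy] by fastforce
    then show ?thesis
    proof cases
      case 2
      then show ?thesis using f_h iso unseparated_mono[OF xy IJ] by simp
    qed simp
  qed
  then have "arrangement_isometric J f"
    using finJ by (simp add: arrangement_isometric_def)
  moreover have "f 0 = 0" by (simp add: f_def)
  moreover have "f x = h x" if "norm (h x) \<le> norm x" for x
    using f_h that by (simp add: g_def power_mono)
  ultimately show ?thesis by blast
qed

section \<open>The folding map that starts the induction\<close>

lemma arrangement_isometric_coordinate_fold:
  "arrangement_isometric ((\<lambda>e. (e, 0)) ` Basis) (\<lambda>x::'a::euclidean_space. \<Sum>e\<in>Basis. (\<bar>x \<bullet> e\<bar> - K) *\<^sub>R e)"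
  unfolding arrangement_isometric_def
proof (intro conjI allI impI)
  fix x y :: 'a
  assume sep: "unseparated ((\<lambda>e. (e, 0)) ` Basis) x y"
  have "(\<bar>x \<bullet> e\<bar> - \<bar>y \<bullet> e\<bar>)\<^sup>2 = (x \<bullet> e - y \<bullet> e)\<^sup>2" if "e \<in> Basis" for e
    using unseparatedD[OF sep, of e 0] that
    by (auto simp: inner_commute power2_eq_square algebra_simps)
  then show "dist (\<Sum>e\<in>Basis. (\<bar>x \<bullet> e\<bar> - K) *\<^sub>R e) (\<Sum>e\<in>Basis. (\<bar>y \<bullet> e\<bar> - K) *\<^sub>R e) = dist x y"
    by (simp add: euclidean_dist_l2[where 'a='a] L2_set_def dist_real_def)
qed simp

text \<open>In the difference of squared distances the quadratic terms in \<open>x\<close> cancel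
  coordinatewise. As \<open>K + b \<bullet> e\<close> exceeds
  \<open>\<bar>a \<bullet> e\<bar>\<close> by at least 1, a term growing at least like
  \<open>2 * \<bar>x \<bullet> e\<bar>\<close> remains.\<close>

lemma coordinate_fold_closer:
  fixes a b :: "'a::euclidean_space"
  assumes K: "norm a + norm b + 1 \<le> K"
  shows "\<forall>\<^sub>F x in at_infinity. dist (\<Sum>e\<in>Basis. (\<bar>x \<bullet> e\<bar> - K) *\<^sub>R e) b < dist x a"
proof -
  \<comment> \<open>\<open>M\<close> collects the constant terms that \<open>2 * norm x\<close> has
    to outweigh.\<close>
  define M where "M = (\<Sum>e\<in>(Basis::'a set). (K + b \<bullet> e)\<^sup>2)"
  have "dist (\<Sum>e\<in>Basis. (\<bar>x \<bullet> e\<bar> - K) *\<^sub>R e) b < dist x a" if x: "norm x \<ge> M + 1" for x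
  proof -
    let ?h = "\<Sum>e\<in>Basis. (\<bar>x \<bullet> e\<bar> - K) *\<^sub>R e"
    have "2 * \<bar>x \<bullet> e\<bar> - (K + b \<bullet> e)\<^sup>2 \<le> (x \<bullet> e - a \<bullet> e)\<^sup>2 - (?h \<bullet> e - b \<bullet> e)\<^sup>2" if e: "e \<in> Basis" for e
    proof -
      have "\<bar>a \<bullet> e\<bar> + \<bar>b \<bullet> e\<bar> \<le> norm a + norm b"
        using e Basis_le_norm by (intro add_mono) auto
      then have "\<bar>a \<bullet> e\<bar> + 1 \<le> K + b \<bullet> e" using K by linarith
      then have "\<bar>x \<bullet> e\<bar> * (\<bar>a \<bullet> e\<bar> + 1) \<le> \<bar>x \<bullet> e\<bar> * (K + b \<bullet> e)" by (intro mult_left_mono) auto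
      moreover have "(x \<bullet> e) * (a \<bullet> e) \<le> \<bar>x \<bullet> e\<bar> * \<bar>a \<bullet> e\<bar>"
        by (metis abs_ge_self abs_mult)
      ultimately have *: "(x \<bullet> e) * (a \<bullet> e) + \<bar>x \<bullet> e\<bar> \<le> \<bar>x \<bullet> e\<bar> * (K + b \<bullet> e)"
        by (simp add: algebra_simps)
      have "?h \<bullet> e - b \<bullet> e = \<bar>x \<bullet> e\<bar> - (K + b \<bullet> e)" using e by simp
      then have "(x \<bullet> e - a \<bullet> e)\<^sup>2 - (?h \<bullet> e - b \<bullet> e)\<^sup>2 =
          (x \<bullet> e - a \<bullet> e)\<^sup>2 - (\<bar>x \<bullet> e\<bar> - (K + b \<bullet> e))\<^sup>2" by (simp only:)
      also have "\<dots> =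
          (a \<bullet> e)\<^sup>2 + 2 * (\<bar>x \<bullet> e\<bar> * (K + b \<bullet> e) - (x \<bullet> e) * (a \<bullet> e)) - (K + b \<bullet> e)\<^sup>2"
        by (simp add: power2_diff algebra_simps)
      also have "\<dots> \<ge> 2 * \<bar>x \<bullet> e\<bar> - (K + b \<bullet> e)\<^sup>2"
      proof -
        have "2 * u - k \<le> c + 2 * (p - q) - k" if "q + u \<le> p" "0 \<le> c" for u k c p q :: real
          using that by argo
        from this[OF * zero_le_power2] show ?thesis .
      qed
      finally show ?thesis .
    qed
    then have "(\<Sum>e\<in>Basis. 2 * \<bar>x \<bullet> e\<bar> - (K + b \<bullet> e)\<^sup>2) \<le>
        (\<Sum>e\<in>Basis. (x \<bullet> e - a \<bullet> e)\<^sup>2 - (?h \<bullet> e - b \<bullet> e)\<^sup>2)"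
      by (rule sum_mono)
    also have "\<dots> = (dist x a)\<^sup>2 - (dist ?h b)\<^sup>2"
      unfolding sum_subtractf
      by (simp only: euclidean_dist_l2[where 'a='a] L2_set_def dist_real_def power2_abs
            real_sqrt_pow2 sum_nonneg zero_le_power2)
    finally have "(\<Sum>e\<in>Basis. 2 * \<bar>x \<bullet> e\<bar>) - M \<le> (dist x a)\<^sup>2 - (dist ?h b)\<^sup>2"
      by (simp add: sum_subtractf M_def)
    moreover have "(\<Sum>e\<in>Basis. 2 * \<bar>x \<bullet> e\<bar>) \<ge> 2 * norm x"
      using norm_le_l1[of x] by (simp add: sum_distrib_left[symmetric])
    moreover have "M \<ge> 0" unfolding M_def by (intro sum_nonneg) auto
    ultimately have "(dist ?h b)\<^sup>2 < (dist x a)\<^sup>2" using x by linarith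
    then show ?thesis by (rule power2_less_imp_less) simp
  qed
  then show ?thesis unfolding eventually_at_infinity by blast
qed

section \<open>Induction over the prescribed points\<close>

lemma arrangement_isometric_extension:
  fixes a b :: "nat \<Rightarrow> 'a::euclidean_space"
  assumes short: "\<And>i j. i \<in> {1..n} \<Longrightarrow> j \<in> {1..n} \<Longrightarrow> dist (b i) (b j) \<le> dist (a i) (a j)"
  shows "\<exists>I f. arrangement_isometric I f \<and> (\<forall>i\<in>{1..n}. f (a i) = b i)"
proof -
  \<comment> \<open>The condition at infinity is carried for all \<open>n\<close> points, since each
    later one becomes an apex.\<close>
  have "\<exists>I f. arrangement_isometric I f \<and> (\<forall>i\<in>{1..k}. f (a i) = b i) \<and>
      (\<forall>i\<in>{1..n}. \<forall>\<^sub>F x in at_infinity. dist (f x) (b i) < dist x (a i))" if "k \<le> n" for k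
    using that
  proof (induction k)
    case 0
    define K where "K = (\<Sum>i\<in>{1..n}. norm (a i) + norm (b i)) + 1"
    have "norm (a i) + norm (b i) + 1 \<le> K" if "i \<in> {1..n}" for i
      unfolding K_def using that
      by (intro add_right_mono member_le_sum[where f = "\<lambda>i. norm (a i) + norm (b i)"]) auto
    then have far0: "\<forall>i\<in>{1..n}. \<forall>\<^sub>F x in at_infinity.
        dist (\<Sum>e\<in>Basis. (\<bar>x \<bullet> e\<bar> - K) *\<^sub>R e) (b i) < dist x (a i)"
      using coordinate_fold_closer by blast
    show ?case
      by (intro exI conjI, rule arrangement_isometric_coordinate_fold[of K], simp, rule far0)
  next
    case (Suc k)
    then obtain I h where h: "arrangement_isometric I h" "\<And>i. i \<in> {1..k} \<Longrightarrow> h (a i) = b i"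
      and far: "\<And>i. i \<in> {1..n} \<Longrightarrow> \<forall>\<^sub>F x in at_infinity. dist (h x) (b i) < dist x (a i)"
      by auto
    let ?p = "a (Suc k)" and ?q = "b (Suc k)"
    have "filterlim (\<lambda>x. x + ?p) at_infinity at_infinity"
      by (rule tendsto_add_filterlim_at_infinity'[OF filterlim_ident tendsto_const])
    then have "\<forall>\<^sub>F x in at_infinity. dist (h (x + ?p)) ?q < dist (x + ?p) ?p"
      using far[of "Suc k"] Suc.prems unfolding filterlim_iff by auto
    then have "\<forall>\<^sub>F x in at_infinity. norm (h (x + ?p) - ?q) < norm x"
      by (simp add: dist_norm)
    from arrangement_isometric_fold_star[OF arrangement_isometric_translate[OF h(1)] this]
    obtain J f where f: "arrangement_isometric J f" "f 0 = 0"
      "\<And>x. norm (h (x + ?p) - ?q) \<le> norm x \<Longrightarrow> f x = h (x + ?p) - ?q" by blast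
    \<comment> \<open>Translation by \<open>- ?p\<close> and \<open>- ?q\<close> undoes the shift to
      the origin, hence the double signs.\<close>
    define F where "F x = f (x + - ?p) - (- ?q)" for x
    have F_h: "F x = h x" if "dist (h x) ?q \<le> dist x ?p" for x
      using f(3)[of "x - ?p"] that by (simp add: F_def dist_norm)
    have "F (a i) = b i" if i: "i \<in> {1..Suc k}" for i
    proof (cases "i = Suc k")
      case True
      then show ?thesis using f(2) by (simp add: F_def)
    next
      case False
      then have "i \<in> {1..k}" using i by auto
      \<comment> \<open>The hypothesis on distances keeps \<open>a i\<close> outside
        \<open>\<Omega>\<close>, so its value survives the coning.\<close>
      then show ?thesis using h(2) F_h[of "a i"] short[of i "Suc k"] Suc.prems by auto
    qed
    moreover have "\<forall>\<^sub>F x in at_infinity. dist (F x) (b i) < dist x (a i)" if "i \<in> {1..n}" for i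
    proof -
      have "\<forall>\<^sub>F x in at_infinity. dist (h x) ?q < dist x ?p" using far Suc.prems by auto
      \<comment> \<open>Far out \<open>h x\<close> is closer to \<open>?q\<close> than
        \<open>x\<close> is to \<open>?p\<close>, so \<open>F\<close> equals \<open>h\<close> there
        and inherits the condition.\<close>
      with far[OF that] show ?thesis by eventually_elim (simp add: F_h)
    qed
    moreover have "arrangement_isometric ((\<lambda>(c,d). (c, d - c \<bullet> (- ?p))) ` J) F"
      unfolding F_def by (rule arrangement_isometric_translate[OF f(1)])
    ultimately show ?case by blast
  qed
  from this[OF order.refl] show ?thesis by blast
qed

theorem mainTheorem2:
  fixes n :: nat and a b :: "nat \<Rightarrow> real^2" and A :: "(real^2) set"
  assumes "\<And>i j. i \<in> {1..n} \<Longrightarrow> j \<in> {1..n} \<Longrightarrow> dist (a i) (a j) \<ge> dist (b i) (b j)"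
    and "convex_polygon A"
    and "\<And>i. i \<in> {1..n} \<Longrightarrow> a i \<in> A"
  shows "\<exists>f :: real^2 \<Rightarrow> real^2.
           piecewise_distance_preserving_on A f \<and> (\<forall>i\<in>{1..n}. f (a i) = b i)"
proof -
  obtain I f where "arrangement_isometric I f" "\<forall>i\<in>{1..n}. f (a i) = b i"
    using arrangement_isometric_extension[of n b a, OF assms(1)] by auto
  then show ?thesis
    using arrangement_isometric_triangulation assms(2) by blast
qed

end
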